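(* Let $(V,\langle\cdot,\cdot,\cdot\rangle,\theta)$ be any multiplicative Hom-Jordan supertriple system. Define on $V$ the ternary operation $[x,y,z]:=\langle x,y,z\rangle-(-1)^{\bar x\bar y}\langle y,x,z\rangle$ for all homogeneous $x,y,z\in V$. Then $(V,[\cdot,\cdot,\cdot],\theta)$ is a multiplicative Hom-Lie supertriple system.
   Context: All vector spaces are over a fixed field of characteristic not $2$ or $3$. A superspace is a $\mathbb Z_2$-graded vector space $V=V_0\oplus V_1$; $\bar x$ is the degree of a homogeneous $x$. A linear map is even if it preserves degrees. A multiplicative ternary Hom-superalgebra $(V,T,\theta)$ is a superspace $V$ with a trilinear operation $T$ satisfying $T(V_i,V_j,V_k)\subseteq V_{i+j+k}$ and an even linear map $\theta:V\to V$ with $\theta(T(x,y,z))=T(\theta(x),\theta(y),\theta(z))$. A multiplicative Hom-Jordan supertriple system is a multiplicative ternary Hom-superalgebra $(V,\langle\cdot,\cdot,\cdot\rangle,\theta)$ such that for all homogeneous elements: $\langle x,y,z\rangle=(-1)^{\bar x\bar y+\bar x\bar z+\bar y\bar z}\langle z,y,x\rangle$, and $\langle\theta(x),\theta(y),\langle u,v,w\rangle\rangle-\langle\langle x,y,u\rangle,\theta(v),\theta(w)\rangle=(-1)^{(\bar x+\bar y)(\bar u+\bar v)}\big(\langle\theta(u),\theta(v),\langle x,y,w\rangle\rangle-\langle\theta(u),\langle v,x,y\rangle,\theta(w)\rangle\big)$. A multiplicative Hom-Lie supertriple system is a multiplicative ternary Hom-superalgebra $(V,[\cdot,\cdot,\cdot],\theta)$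 such that for all homogeneous elements: $[x,y,z]=-(-1)^{\bar x\bar y}[y,x,z]$; $[x,y,z]+(-1)^{\bar x(\bar y+\bar z)}[y,z,x]+(-1)^{\bar z(\bar x+\bar y)}[z,x,y]=0$; $[\theta(x),\theta(y),[u,v,w]]=[[x,y,u],\theta(v),\theta(w)]+(-1)^{\bar u(\bar x+\bar y)}[\theta(u),[x,y,v],\theta(w)]+(-1)^{(\bar x+\bar y)(\bar u+\bar v)}[\theta(u),\theta(v),[x,y,w]]$. *)

theory Defs
  imports Complex_Main "HOL-Library.Z2"
begin

text \<open>
  Degrees live in \<open>bit\<close>, the field with two elements: its addition is addition of degrees, and
  its multiplication gives the products of degrees in the exponents of the signs. \<open>koszul i\<close> is the
  scalar \<open>(-1)^i\<close>, which depends only on \<open>i\<close> modulo 2.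
\<close>

definition koszul :: "bit \<Rightarrow> 'k::ring_1" where
  "koszul i = (if i = 0 then 1 else - 1)"

locale superspace = vector_space scale
  for scale :: "'k::field \<Rightarrow> 'v::ab_group_add \<Rightarrow> 'v" (infixr "*s" 75) +
  fixes V :: "bit \<Rightarrow> 'v set"
  assumes subspace_component: "subspace (V i)"
    and components_span: "\<exists>a\<in>V 0. \<exists>b\<in>V 1. v = a + b"
    and components_disjoint: "V 0 \<inter> V 1 = {0}"

definition trilinear ::
  "('k::field \<Rightarrow> 'v::ab_group_add \<Rightarrow> 'v) \<Rightarrow> ('v \<Rightarrow> 'v \<Rightarrow> 'v \<Rightarrow> 'v) \<Rightarrow> bool" where
  "trilinear scale T \<longleftrightarrow>
     (\<forall>y z. Vector_Spaces.linear scale scale (\<lambda>x. T x y z)) \<and>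
     (\<forall>x z. Vector_Spaces.linear scale scale (\<lambda>y. T x y z)) \<and>
     (\<forall>x y. Vector_Spaces.linear scale scale (\<lambda>z. T x y z))"

locale mult_ternary_hom_superalgebra = superspace scale V
  for scale :: "'k::field \<Rightarrow> 'v::ab_group_add \<Rightarrow> 'v" (infixr "*s" 75)
    and V :: "bit \<Rightarrow> 'v set" +
  fixes T :: "'v \<Rightarrow> 'v \<Rightarrow> 'v \<Rightarrow> 'v"
    and \<theta> :: "'v \<Rightarrow> 'v"
  assumes trilinear_T: "trilinear scale T"
    and T_graded: "\<lbrakk>x \<in> V i; y \<in> V j; z \<in> V k\<rbrakk> \<Longrightarrow> T x y z \<in> V (i + j + k)"
    and linear_\<theta>: "Vector_Spaces.linear scale scale \<theta>"
    and \<theta>_even: "x \<in> V i \<Longrightarrow> \<theta> x \<in> V i"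
    and \<theta>_mult: "\<theta> (T x y z) = T (\<theta> x) (\<theta> y) (\<theta> z)"

text \<open>
  In the identities below every homogeneous element comes with a degree. The zero vector has both
  degrees, which is harmless: each identity is linear in each of its variables.
\<close>

locale mult_hom_jordan_supertriple_system =
  mult_ternary_hom_superalgebra scale V J \<theta>
  for scale :: "'k::field \<Rightarrow> 'v::ab_group_add \<Rightarrow> 'v" (infixr "*s" 75)
    and V :: "bit \<Rightarrow> 'v set"
    and J :: "'v \<Rightarrow> 'v \<Rightarrow> 'v \<Rightarrow> 'v"
    and \<theta> :: "'v \<Rightarrow> 'v" +
  assumes outer_supersymmetry:
    "\<lbrakk>x \<in> V dx; y \<in> V dy; z \<in> V dz\<rbrakk> \<Longrightarrow>
       J x y z = koszul (dx * dy + dx * dz + dy * dz) *s J z y x"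
    and hom_jordan_identity:
    "\<lbrakk>x \<in> V dx; y \<in> V dy; u \<in> V du; v \<in> V dv; w \<in> V dw\<rbrakk> \<Longrightarrow>
       J (\<theta> x) (\<theta> y) (J u v w) - J (J x y u) (\<theta> v) (\<theta> w) =
       koszul ((dx + dy) * (du + dv)) *s
         (J (\<theta> u) (\<theta> v) (J x y w) - J (\<theta> u) (J v x y) (\<theta> w))"

locale mult_hom_lie_supertriple_system =
  mult_ternary_hom_superalgebra scale V B \<theta>
  for scale :: "'k::field \<Rightarrow> 'v::ab_group_add \<Rightarrow> 'v" (infixr "*s" 75)
    and V :: "bit \<Rightarrow> 'v set"
    and B :: "'v \<Rightarrow> 'v \<Rightarrow> 'v \<Rightarrow> 'v"
    and \<theta> :: "'v \<Rightarrow> 'v" +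
  assumes left_super_skew:
    "\<lbrakk>x \<in> V dx; y \<in> V dy; z \<in> V dz\<rbrakk> \<Longrightarrow>
       B x y z = - (koszul (dx * dy) *s B y x z)"
    and super_cyclic:
    "\<lbrakk>x \<in> V dx; y \<in> V dy; z \<in> V dz\<rbrakk> \<Longrightarrow>
       B x y z + koszul (dx * (dy + dz)) *s B y z x + koszul (dz * (dx + dy)) *s B z x y = 0"
    and hom_nambu_identity:
    "\<lbrakk>x \<in> V dx; y \<in> V dy; u \<in> V du; v \<in> V dv; w \<in> V dw\<rbrakk> \<Longrightarrow>
       B (\<theta> x) (\<theta> y) (B u v w) =
         B (B x y u) (\<theta> v) (\<theta> w)
         + koszul (du * (dx + dy)) *s B (\<theta> u) (B x y v) (\<theta> w)
         + koszul ((dx + dy) * (du + dv)) *s B (\<theta> u) (\<theta> v) (B x y w)"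

text \<open>
  The formula \<open>[x,y,z] = \<langle>x,y,z\<rangle> - (-1)^(xy) \<langle>y,x,z\<rangle>\<close> is meaningful only on homogeneous elements;
  the operation on the whole space is its trilinear extension.
\<close>

definition is_super_commutator ::
  "('k::field \<Rightarrow> 'v::ab_group_add \<Rightarrow> 'v) \<Rightarrow> (bit \<Rightarrow> 'v set) \<Rightarrow> ('v \<Rightarrow> 'v \<Rightarrow> 'v \<Rightarrow> 'v) \<Rightarrow>
   ('v \<Rightarrow> 'v \<Rightarrow> 'v \<Rightarrow> 'v) \<Rightarrow> bool" where
  "is_super_commutator scale V J B \<longleftrightarrow>
     trilinear scale B \<and>
     (\<forall>dx dy dz. \<forall>x\<in>V dx. \<forall>y\<in>V dy. \<forall>z\<in>V dz.
        B x y z = J x y z - scale (koszul (dx * dy)) (J y x z))"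

end

theory Submission
  imports Defs
begin

text \<open>
  By outer supersymmetry, the Hom-Jordan identity says how \<open>\<langle>x,y,-\<rangle>\<close> acts on \<open>\<langle>u,v,w\<rangle>\<close>, with
  \<open>\<langle>y,x,v\<rangle>\<close> in place of \<open>\<langle>x,y,v\<rangle>\<close> in the middle slot. Super-antisymmetrizing in \<open>x, y\<close> turns
  it into a \<open>\<theta>\<close>-twisted superderivation of \<open>\<langle>u,v,w\<rangle>\<close>, hence of every operation built from it by
  permuting arguments. The cyclic identity comes from cancellation under outer supersymmetry alone.
\<close>

lemma bit_eq_0_or_1: "(i::bit) = 0 \<or> i = 1"
  by (cases i) auto

section \<open>Projection onto the odd component\<close>

context superspace
begin

text \<open>The projection onto \<open>V 1\<close> along \<open>V 0\<close>, picked by choice. It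
  supplies the term correcting the sign on odd arguments when the commutator is written as one
  formula on the whole space.\<close>

definition odd_part :: "'v \<Rightarrow> 'v" where
  "odd_part v = (SOME b. b \<in> V 1 \<and> v - b \<in> V 0)"

lemma odd_part_mem: "odd_part v \<in> V 1"
  and even_part_mem: "v - odd_part v \<in> V 0"
proof -
  obtain a b where "a \<in> V 0" "b \<in> V 1" "v = a + b"
    using components_span by blast
  then have "b \<in> V 1 \<and> v - b \<in> V 0" by simp
  then have "odd_part v \<in> V 1 \<and> v - odd_part v \<in> V 0"
    unfolding odd_part_def by (rule someI)
  then show "odd_part v \<in> V 1" "v - odd_part v \<in> V 0" by auto
qed

text \<open>Two candidates differ by an element of \<open>V 0 \<inter> V 1\<close>. Values and
  linearity of the projection then follow by exhibiting a candidate.\<close>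

lemma odd_part_unique:
  assumes "b \<in> V 1" "v - b \<in> V 0"
  shows "odd_part v = b"
proof -
  have "odd_part v - b \<in> V 1"
    using subspace_diff[OF subspace_component odd_part_mem assms(1)] .
  moreover have "odd_part v - b \<in> V 0"
    using subspace_diff[OF subspace_component assms(2) even_part_mem[of v]] by simp
  ultimately have "odd_part v - b \<in> {0}"
    unfolding components_disjoint[symmetric] by blast
  then show ?thesis by simp
qed

lemma odd_part_even: "v \<in> V 0 \<Longrightarrow> odd_part v = 0"
  by (rule odd_part_unique) (auto intro: subspace_0 subspace_component)

lemma odd_part_odd: "v \<in> V 1 \<Longrightarrow> odd_part v = v"
  by (rule odd_part_unique) (auto intro: subspace_0 subspace_component)

lemma odd_part_add: "odd_part (v + w) = odd_part v + odd_part w"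
proof (rule odd_part_unique)
  show "odd_part v + odd_part w \<in> V 1"
    by (intro subspace_add subspace_component odd_part_mem)
  have "(v - odd_part v) + (w - odd_part w) \<in> V 0"
    by (intro subspace_add subspace_component even_part_mem)
  then show "v + w - (odd_part v + odd_part w) \<in> V 0"
    by (simp add: algebra_simps)
qed

lemma odd_part_scale: "odd_part (c *s v) = c *s odd_part v"
proof (rule odd_part_unique)
  show "c *s odd_part v \<in> V 1"
    by (intro subspace_scale subspace_component odd_part_mem)
  have "c *s (v - odd_part v) \<in> V 0"
    by (intro subspace_scale subspace_component even_part_mem)
  then show "c *s v - c *s odd_part v \<in> V 0"
    by (simp add: scale_right_diff_distrib)
qed

section \<open>Trilinear operations and the commutator on the whole space\<close>

lemma trilinear_iff:
  "trilinear scale T \<longleftrightarrow>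
     (\<forall>x x' y z. T (x + x') y z = T x y z + T x' y z) \<and>
     (\<forall>x y y' z. T x (y + y') z = T x y z + T x y' z) \<and>
     (\<forall>x y z z'. T x y (z + z') = T x y z + T x y z') \<and>
     (\<forall>c x y z. T (c *s x) y z = c *s T x y z) \<and>
     (\<forall>c x y z. T x (c *s y) z = c *s T x y z) \<and>
     (\<forall>c x y z. T x y (c *s z) = c *s T x y z)"
  unfolding trilinear_def Vector_Spaces.linear_iff by (auto simp: vector_space_axioms)

lemma trilinear_diff:
  assumes "trilinear scale T"
  shows "T (x - x') y z = T x y z - T x' y z"
    and "T x (y - y') z = T x y z - T x y' z"
    and "T x y (z - z') = T x y z - T x y z'"
proof -
  have add: "\<And>x x' y z. T (x + x') y z = T x y z + T x' y z"
    "\<And>x y y' z. T x (y + y') z = T x y z + T x y' z"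
    "\<And>x y z z'. T x y (z + z') = T x y z + T x y z'"
    using assms unfolding trilinear_iff by simp_all
  show "T (x - x') y z = T x y z - T x' y z"
    using add(1)[of "x - x'" x' y z] by simp
  show "T x (y - y') z = T x y z - T x y' z"
    using add(2)[of x "y - y'" y' z] by simp
  show "T x y (z - z') = T x y z - T x y z'"
    using add(3)[of x y "z - z'" z'] by simp
qed

lemma trilinear_minus:
  assumes "trilinear scale T"
  shows "T (- x) y z = - T x y z" "T x (- y) z = - T x y z" "T x y (- z) = - T x y z"
  using trilinear_diff(1)[OF assms, of 0 x y z] trilinear_diff(1)[OF assms, of 0 0 y z]
    trilinear_diff(2)[OF assms, of x 0 y z] trilinear_diff(2)[OF assms, of x 0 0 z]
    trilinear_diff(3)[OF assms, of x y 0 z] trilinear_diff(3)[OF assms, of x y 0 0]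
  by simp_all

lemma trilinear_zero:
  assumes "trilinear scale T"
  shows "T 0 y z = 0" "T x 0 z = 0" "T x y 0 = 0"
  using trilinear_diff(1)[OF assms, of 0 0 y z] trilinear_diff(2)[OF assms, of x 0 0 z]
    trilinear_diff(3)[OF assms, of x y 0 0]
  by simp_all

text \<open>Splitting each argument into an even and an odd summand expands both sides into eight
  homogeneous terms. This carries identities whose signs need degrees over to arbitrary
  vectors.\<close>

lemma trilinear_eqI:
  assumes S: "trilinear scale S" and T: "trilinear scale T"
    and eq: "\<And>i j k x y z. x \<in> V i \<Longrightarrow> y \<in> V j \<Longrightarrow> z \<in> V k \<Longrightarrow> S x y z = T x y z"
  shows "S = T"
proof (intro ext)
  fix x y z
  obtain x0 x1 where x: "x0 \<in> V 0" "x1 \<in> V 1" "x = x0 + x1" using components_span by blast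
  obtain y0 y1 where y: "y0 \<in> V 0" "y1 \<in> V 1" "y = y0 + y1" using components_span by blast
  obtain z0 z1 where z: "z0 \<in> V 0" "z1 \<in> V 1" "z = z0 + z1" using components_span by blast
  have addS: "\<And>x x' y z. S (x + x') y z = S x y z + S x' y z"
    "\<And>x y y' z. S x (y + y') z = S x y z + S x y' z"
    "\<And>x y z z'. S x y (z + z') = S x y z + S x y z'"
    using S unfolding trilinear_iff by simp_all
  have addT: "\<And>x x' y z. T (x + x') y z = T x y z + T x' y z"
    "\<And>x y y' z. T x (y + y') z = T x y z + T x y' z"
    "\<And>x y z z'. T x y (z + z') = T x y z + T x y z'"
    using T unfolding trilinear_iff by simp_all
  show "S x y z = T x y z"
    unfolding x(3) y(3) z(3) addS addT using x y z by (simp add: eq)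
qed

lemma is_super_commutator_unique:
  assumes "is_super_commutator scale V J B" "is_super_commutator scale V J B'"
  shows "B = B'"
proof (rule trilinear_eqI)
  show "trilinear scale B" "trilinear scale B'"
    using assms unfolding is_super_commutator_def by auto
  fix i j k x y z assume "x \<in> V i" "y \<in> V j" "z \<in> V k"
  then show "B x y z = B' x y z"
    using assms unfolding is_super_commutator_def by metis
qed

text \<open>
  The sign is \<open>-1\<close> only when both swapped arguments are odd, so \<open>\<langle>x,y,z\<rangle> - \<langle>y,x,z\<rangle>\<close> is off by exactly
  \<open>2\<langle>y\<^sub>1,x\<^sub>1,z\<rangle>\<close>, where \<open>x\<^sub>1, y\<^sub>1\<close> are the odd parts.
\<close>
lemma is_super_commutator_exists:
  assumes J: "trilinear scale J"
  shows "\<exists>B. is_super_commutator scale V J B"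
proof
  let ?B = "\<lambda>x y z. J x y z - J y x z
              + (J (odd_part y) (odd_part x) z + J (odd_part y) (odd_part x) z)"
  note iff = J[unfolded trilinear_iff]
  have "trilinear scale ?B"
    unfolding trilinear_iff
    by (simp add: iff odd_part_add odd_part_scale scale_right_distrib
        scale_right_diff_distrib algebra_simps)
  moreover have "?B x y z = J x y z - koszul (dx * dy) *s J y x z"
    if "x \<in> V dx" "y \<in> V dy" for dx dy x y z
    using that bit_eq_0_or_1[of dx] bit_eq_0_or_1[of dy]
    by (auto simp: koszul_def odd_part_even odd_part_odd trilinear_zero[OF J])
  ultimately show "is_super_commutator scale V J ?B"
    unfolding is_super_commutator_def by blast
qed

end

section \<open>Grading and multiplicativity of the commutator\<close>

context mult_ternary_hom_superalgebra
begin

lemma super_commutator_superalgebra: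
  assumes "is_super_commutator scale V T B"
  shows "mult_ternary_hom_superalgebra scale V B \<theta>"
proof
  show B: "trilinear scale B"
    using assms unfolding is_super_commutator_def by blast
  have B_eq: "B x y z = T x y z - koszul (dx * dy) *s T y x z"
    if "x \<in> V dx" "y \<in> V dy" "z \<in> V dz" for dx dy dz x y z
    using assms that unfolding is_super_commutator_def by blast
  show "B x y z \<in> V (i + j + k)" if "x \<in> V i" "y \<in> V j" "z \<in> V k" for x y z i j k
  proof -
    have "T y x z \<in> V (i + j + k)" using T_graded[OF that(2,1,3)] unfolding add.commute[of j i] .
    then show ?thesis
      unfolding B_eq[OF that] using T_graded[OF that]
      by (intro subspace_diff subspace_scale subspace_component)
  qed
  have lin: "\<theta> (x + y) = \<theta> x + \<theta> y" "\<theta> (c *s x) = c *s \<theta> x" for x y c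
    using linear_\<theta> unfolding Vector_Spaces.linear_iff by auto
  have lin_diff: "\<theta> (x - y) = \<theta> x - \<theta> y" for x y
    using lin(1)[of "x - y" y] by simp
  \<comment> \<open>Multiplicativity is required for all vectors, but \<open>B_eq\<close> holds only
    on homogeneous ones. Both sides are trilinear, so comparing them there suffices.\<close>
  have "(\<lambda>x y z. \<theta> (B x y z)) = (\<lambda>x y z. B (\<theta> x) (\<theta> y) (\<theta> z))"
  proof (rule trilinear_eqI)
    show "trilinear scale (\<lambda>x y z. \<theta> (B x y z))" "trilinear scale (\<lambda>x y z. B (\<theta> x) (\<theta> y) (\<theta> z))"
      using B unfolding trilinear_iff by (simp_all add: lin)
    fix i j k x y z assume *: "x \<in> V i" "y \<in> V j" "z \<in> V k"
    show "\<theta> (B x y z) = B (\<theta> x) (\<theta> y) (\<theta> z)"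
      unfolding B_eq[OF *] B_eq[OF \<theta>_even[OF *(1)] \<theta>_even[OF *(2)] \<theta>_even[OF *(3)]]
      by (simp add: lin lin_diff \<theta>_mult)
  qed
  then show "\<theta> (B x y z) = B (\<theta> x) (\<theta> y) (\<theta> z)" for x y z by meson
qed (use linear_\<theta> \<theta>_even in \<open>auto simp: Vector_Spaces.linear_iff\<close>)

end

section \<open>From the Hom-Jordan to the Hom-Lie identities\<close>

context mult_hom_jordan_supertriple_system
begin

lemma super_commutator_derivation_of_J:
  assumes B: "is_super_commutator scale V J B"
    and x: "x \<in> V dx" and y: "y \<in> V dy" and u: "u \<in> V du" and v: "v \<in> V dv" and w: "w \<in> V dw"
  shows "B (\<theta> x) (\<theta> y) (J u v w) =
      J (B x y u) (\<theta> v) (\<theta> w)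
      + koszul (du * (dx + dy)) *s J (\<theta> u) (B x y v) (\<theta> w)
      + koszul ((dx + dy) * (du + dv)) *s J (\<theta> u) (\<theta> v) (B x y w)"
proof -
  have B_eq: "B x y z = J x y z - koszul (dx * dy) *s J y x z"
    if "x \<in> V dx" "y \<in> V dy" "z \<in> V dz" for dx dy dz x y z
    using B that unfolding is_super_commutator_def by blast
  note E = B_eq[OF x y u] B_eq[OF x y v] B_eq[OF x y w]
    B_eq[OF \<theta>_even[OF x] \<theta>_even[OF y] T_graded[OF u v w]]
  \<comment> \<open>These turn the middle-slot terms \<open>J v x y\<close> and
    \<open>J v y x\<close> into signed \<open>J y x v\<close> and \<open>J x y v\<close>, the two
    halves of \<open>B x y v\<close>.\<close>
  note S = outer_supersymmetry[OF v x y] outer_supersymmetry[OF v y x]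
  note H = hom_jordan_identity[OF x y u v w, unfolded S diff_eq_eq]
    hom_jordan_identity[OF y x u v w, unfolded S diff_eq_eq]
  note lin = trilinear_T[unfolded trilinear_iff] trilinear_diff[OF trilinear_T]
    trilinear_minus[OF trilinear_T]
  \<comment> \<open>No sign left here involves the degree of \<open>w\<close>, so sixteen parity
    cases are enough.\<close>
  show ?thesis
    unfolding E H using bit_eq_0_or_1[of dx] bit_eq_0_or_1[of dy] bit_eq_0_or_1[of du]
      bit_eq_0_or_1[of dv]
    by (elim disjE) (simp_all add: koszul_def lin)
qed

theorem super_commutator_lie:
  assumes "is_super_commutator scale V J B"
  shows "mult_hom_lie_supertriple_system scale V B \<theta>"
proof -
  interpret B: mult_ternary_hom_superalgebra scale V B \<theta>
    using assms by (rule super_commutator_superalgebra)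
  have B_eq: "B x y z = J x y z - koszul (dx * dy) *s J y x z"
    if "x \<in> V dx" "y \<in> V dy" "z \<in> V dz" for dx dy dz x y z
    using assms that unfolding is_super_commutator_def by blast
  show ?thesis
  proof
    fix dx dy dz x y z assume x: "x \<in> V dx" and y: "y \<in> V dy" and z: "z \<in> V dz"
    note cases = bit_eq_0_or_1[of dx] bit_eq_0_or_1[of dy] bit_eq_0_or_1[of dz]
    show "B x y z = - (koszul (dx * dy) *s B y x z)"
      unfolding B_eq[OF x y z] B_eq[OF y x z] using cases
      by (elim disjE; simp add: koszul_def)
    show "B x y z + koszul (dx * (dy + dz)) *s B y z x + koszul (dz * (dx + dy)) *s B z x y = 0"
      \<comment> \<open>Reversing the subtracted terms \<open>J y x z\<close>,
        \<open>J z y x\<close>, \<open>J x z y\<close> gives signed copies of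
        \<open>J z x y\<close>, \<open>J x y z\<close>, \<open>J y z x\<close>, which cancel the
        positive terms.\<close>
      unfolding B_eq[OF x y z] B_eq[OF y z x] B_eq[OF z x y]
        outer_supersymmetry[OF z y x] outer_supersymmetry[OF x z y] outer_supersymmetry[OF y x z]
      using cases by (elim disjE; simp add: koszul_def)
  next
    fix dx dy du dv dw x y u v w
    assume x: "x \<in> V dx" and y: "y \<in> V dy" and u: "u \<in> V du" and v: "v \<in> V dv" and w: "w \<in> V dw"
    note \<theta>e = \<theta>_even[OF x] \<theta>_even[OF y] \<theta>_even[OF u] \<theta>_even[OF v] \<theta>_even[OF w]
    \<comment> \<open>\<open>B u v w\<close> combines \<open>J u v w\<close> and
      \<open>J v u w\<close>, so the derivation rule is needed for both orders of \<open>u\<close>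
      and \<open>v\<close>.\<close>
    note der = super_commutator_derivation_of_J[OF assms x y u v w]
      super_commutator_derivation_of_J[OF assms x y v u w]
    \<comment> \<open>Only \<open>B u v w\<close> and the outer brackets on the right are expanded.
      The inner brackets \<open>B x y _\<close> stay intact, matching the form that
      \<open>der\<close> produces on the left.\<close>
    note E = B_eq[OF u v w] B_eq[OF B.T_graded[OF x y u] \<theta>e(4,5)]
      B_eq[OF \<theta>e(3) B.T_graded[OF x y v] \<theta>e(5)] B_eq[OF \<theta>e(3,4) B.T_graded[OF x y w]]
    note lin = B.trilinear_T[unfolded trilinear_iff] trilinear_diff[OF B.trilinear_T]
      trilinear_minus[OF B.trilinear_T]
    show "B (\<theta> x) (\<theta> y) (B u v w) = B (B x y u) (\<theta> v) (\<theta> w)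
        + koszul (du * (dx + dy)) *s B (\<theta> u) (B x y v) (\<theta> w)
        + koszul ((dx + dy) * (du + dv)) *s B (\<theta> u) (\<theta> v) (B x y w)"
      unfolding E using bit_eq_0_or_1[of dx] bit_eq_0_or_1[of dy] bit_eq_0_or_1[of du]
        bit_eq_0_or_1[of dv]
      by (elim disjE) (simp_all add: koszul_def lin der algebra_simps)
  qed
qed

end

theorem theorem7p2:
  fixes scale :: "'k::field \<Rightarrow> 'v::ab_group_add \<Rightarrow> 'v"
    and V :: "bit \<Rightarrow> 'v set"
    and J :: "'v \<Rightarrow> 'v \<Rightarrow> 'v \<Rightarrow> 'v"
    and \<theta> :: "'v \<Rightarrow> 'v"
  assumes "CHAR('k) \<noteq> 2" and "CHAR('k) \<noteq> 3"
    and "mult_hom_jordan_supertriple_system scale V J \<theta>"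
  shows "(\<exists>!B. is_super_commutator scale V J B) \<and>
         (\<forall>B. is_super_commutator scale V J B \<longrightarrow>
              mult_hom_lie_supertriple_system scale V B \<theta>)"
proof -
  interpret mult_hom_jordan_supertriple_system scale V J \<theta> by (rule assms(3))
  show ?thesis
    using is_super_commutator_exists[OF trilinear_T] is_super_commutator_unique
      super_commutator_lie by blast
qed

end
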